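(* Let $\Sigma=[\sigma_{hk}]$ be a $p\times p$ Hermitian positive definite complex matrix and let $\alpha=(n_1,m_1,\dots,n_p,m_p)\in\mathbb Z_{\ge0}^{2p}$. Let $N=\{h:n_h\neq0\}$, $M=\{k:m_k\neq0\}$, $S^N_h=\{k\in M:\sigma_{hk}\neq0\}$ for $h\in N$, and let $\{M_1,\dots,M_q\}$ be the partition of $M$ induced by the sets $S^N_h$. Assume that for every $r=1,\dots,q$, $$\sum_{i\in N:\ S^N_i\subset M_r} n_i=\sum_{j\in M_r} m_j .$$ Then the $\alpha$-moment of $\mathcal{CN}_p(\Sigma)$ is $$\nu(\alpha)=\sum_{a\in I(\alpha)}\Pi(\alpha,a),\qquad \Pi(\alpha,a)=\prod_{h=1}^p n_h!\,m_h!\prod_{h,k=1}^p\frac{\sigma_{hk}^{a_{hk}}}{a_{hk}!},$$ where $\sigma_{hk}^0:=1$ also when $\sigma_{hk}=0$.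
   Context: The complex normal distribution $\mathcal{CN}_p(\Sigma)$ on $\mathbb C^p\cong\mathbb R^{2p}$ has density $\varphi(z;\Sigma)=\frac{1}{\pi^p\det\Sigma}\exp(-z^*\Sigma^{-1}z)$ with respect to Lebesgue measure $dz$ on $\mathbb R^{2p}$. For a multi-index $\alpha=(n_1,m_1,\dots,n_p,m_p)\in\mathbb Z_{\ge0}^{2p}$ the $\alpha$-moment is $\nu(\alpha)=\int_{\mathbb C^p}\prod_{j=1}^p z_j^{n_j}\bar z_j^{m_j}\varphi(z;\Sigma)\,dz$; in particular $\sigma_{hk}=\nu(e_{2h-1}+e_{2k})$ (the entries of $\Sigma$). Induced partition: form the graph with vertex set $M$ in which two vertices are joined iff both belong to the same $S^N_h$ for some $h\in N$; its connected components form the partition of $M$ induced by the $S^N_h$. The set $I(\alpha)$: it is the set of vectors $a=(a_{11},\dots,a_{1p},a_{21},\dots,a_{pp})\in\mathbb Z_{\ge0}^{p^2}$ such that $l_{ij}(\alpha,a)\le a_{ij}\le L_{ij}(\alpha,a)$ for all $i,j=1,\dots,p$, where $$l_{ij}(\alpha,a)=\max\Big(0,\ \sum_{h=1}^i n_h-\sum_{h=j+1}^p m_h-\sum_{\substack{h\le i,\,k\le j\\ (h,k)\neq(i,j)}}a_{hk}\Big),\qquad L_{ij}(\alpha,a)=\min\Big(n_i-\sum_{h=1}^{j-1}a_{ih},\ m_j-\sum_{h=1}^{i-1}a_{hj}\Big).$$ (The paper writes $\wedge$ for this max and $\vee$ for this min.) *)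

theory Defs
  imports "HOL-Probability.Probability" "Jordan_Normal_Form.Determinant"
begin

text \<open>Conventions: indices are 0-based, i.e. the paper's index h = 1..p corresponds to
  h = 0..p-1 here.  The multi-index alpha = (n_1,m_1,...,n_p,m_p) is given by the two
  functions n, m :: nat => nat (only values below p matter).  The covariance matrix
  Sigma is a p x p complex matrix (Jordan_Normal_Form).  A point z of C^p is a function
  nat => complex (coordinates 0..p-1), and C^p = R^(2p) carries the product of the
  Lebesgue measures lborel on complex = R^2.\<close>

definition hermitian_pd :: "nat \<Rightarrow> complex mat \<Rightarrow> bool" where
  "hermitian_pd p S \<longleftrightarrow> S \<in> carrier_mat p p
     \<and> (\<forall>i<p. \<forall>j<p. S $$ (i,j) = cnj (S $$ (j,i)))
     \<and> (\<forall>v \<in> carrier_vec p. v \<noteq> 0\<^sub>v p \<longrightarrow> Re (scalar_prod (conjugate v) (S *\<^sub>v v)) > 0)"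

definition inv_mat :: "nat \<Rightarrow> complex mat \<Rightarrow> complex mat" where
  "inv_mat p S = (THE B. B \<in> carrier_mat p p \<and> S * B = 1\<^sub>m p \<and> B * S = 1\<^sub>m p)"

definition cn_density :: "nat \<Rightarrow> complex mat \<Rightarrow> (nat \<Rightarrow> complex) \<Rightarrow> complex" where
  "cn_density p S z =
     (let zv = Matrix.vec p z in
      exp (- scalar_prod (conjugate zv) (inv_mat p S *\<^sub>v zv)) / (complex_of_real pi ^ p * Determinant.det S))"

definition lebesgue_Cp :: "nat \<Rightarrow> (nat \<Rightarrow> complex) measure" where
  "lebesgue_Cp p = PiM {..<p} (\<lambda>_. (lborel :: complex measure))"

definition cn_moment :: "nat \<Rightarrow> complex mat \<Rightarrow> (nat \<Rightarrow> nat) \<Rightarrow> (nat \<Rightarrow> nat) \<Rightarrow> complex" where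
  "cn_moment p S n m =
     (LINT z | lebesgue_Cp p. (\<Prod>j<p. z j ^ n j * cnj (z j) ^ m j) * cn_density p S z)"

definition induced_partition :: "nat set \<Rightarrow> nat set \<Rightarrow> (nat \<Rightarrow> nat set) \<Rightarrow> nat set set" where
  "induced_partition V H T =
     (let E = {(j,k). j \<in> V \<and> k \<in> V \<and> (\<exists>h\<in>H. j \<in> T h \<and> k \<in> T h)}
      in {{y \<in> V. (x,y) \<in> E\<^sup>*} | x. x \<in> V})"

definition l_bound :: "nat \<Rightarrow> (nat \<Rightarrow> nat) \<Rightarrow> (nat \<Rightarrow> nat) \<Rightarrow> (nat \<Rightarrow> nat \<Rightarrow> nat) \<Rightarrow> nat \<Rightarrow> nat \<Rightarrow> int" where
  "l_bound p n m a i j = max 0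
     ((\<Sum>h\<in>{..i}. int (n h)) - (\<Sum>h\<in>{j<..<p}. int (m h))
      - (\<Sum>(h,k)\<in>({..i} \<times> {..j}) - {(i,j)}. int (a h k)))"

definition L_bound :: "(nat \<Rightarrow> nat) \<Rightarrow> (nat \<Rightarrow> nat) \<Rightarrow> (nat \<Rightarrow> nat \<Rightarrow> nat) \<Rightarrow> nat \<Rightarrow> nat \<Rightarrow> int" where
  "L_bound n m a i j = min
     (int (n i) - (\<Sum>h<j. int (a i h)))
     (int (m j) - (\<Sum>h<i. int (a h j)))"

definition I_set :: "nat \<Rightarrow> (nat \<Rightarrow> nat) \<Rightarrow> (nat \<Rightarrow> nat) \<Rightarrow> (nat \<Rightarrow> nat \<Rightarrow> nat) set" where
  "I_set p n m = {a. (\<forall>i j. (p \<le> i \<or> p \<le> j) \<longrightarrow> a i j = 0)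
       \<and> (\<forall>i<p. \<forall>j<p. l_bound p n m a i j \<le> int (a i j) \<and> int (a i j) \<le> L_bound n m a i j)}"

text \<open>Pi(alpha, a); note that 0 ^ 0 = 1 in Isabelle, matching the convention sigma^0 = 1.\<close>
definition Pi_term :: "nat \<Rightarrow> complex mat \<Rightarrow> (nat \<Rightarrow> nat) \<Rightarrow> (nat \<Rightarrow> nat) \<Rightarrow> (nat \<Rightarrow> nat \<Rightarrow> nat) \<Rightarrow> complex" where
  "Pi_term p S n m a =
     (\<Prod>h<p. of_nat (fact (n h) * fact (m h)))
     * (\<Prod>h<p. \<Prod>k<p. S $$ (h,k) ^ a h k / of_nat (fact (a h k)))"

end

theory Submission
  imports Defs
begin

text \<open>
  Write \<open>B\<close> for the inverse of \<open>\<Sigma>\<close>. Integration by parts in the \<open>k\<close>-th complex coordinate gives Stein's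
  identity \<open>(\<Sum>j. B\<^sub>k\<^sub>j \<nu>(n + e\<^sub>j, m)) = m\<^sub>k \<nu>(n, m - e\<^sub>k)\<close>, and applying \<open>\<Sigma>\<close> turns it into the Wick
  recursion \<open>\<nu>(n + e\<^sub>h, m) = (\<Sum>k. \<sigma>\<^sub>h\<^sub>k m\<^sub>k \<nu>(n, m - e\<^sub>k))\<close>. The sum of \<open>\<Pi>(\<alpha>, a)\<close> over all contingency
  tables \<open>a\<close> with row sums \<open>n\<close> and column sums \<open>m\<close> satisfies the same recursion, so it equals
  \<open>\<nu>(\<alpha>)\<close> without any balance assumption. If \<open>n\<close> and \<open>m\<close> have equal totals, \<open>I(\<alpha>)\<close> is exactly the set
  of these tables. If the totals differ, there are no such tables, so \<open>\<nu>(\<alpha>) = 0\<close>; the balance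
  assumption then forces some \<open>h\<close> with \<open>n\<^sub>h \<noteq> 0\<close> and \<open>S\<^sup>N\<^sub>h = {}\<close>, and since elements of \<open>I(\<alpha>)\<close> always
  have row sums \<open>n\<close> and column sums at most \<open>m\<close>, every \<open>\<Pi>(\<alpha>, a)\<close> contains a factor \<open>0\<close>.
\<close>

subsection \<open>Integration over Euclidean spaces\<close>

lemma
  fixes f :: "'a::euclidean_space \<Rightarrow> 'b::{banach, second_countable_topology}"
  assumes f: "f \<in> borel_measurable borel"
  shows lborel_integrable_translate: "integrable lborel (\<lambda>x. f (x + c)) \<longleftrightarrow> integrable lborel f"
    and lborel_integral_translate: "(LINT x|lborel. f (x + c)) = (LINT x|lborel. f x)"
proof -
  have plus: "(+) c \<in> measurable lborel borel" by simp
  show "integrable lborel (\<lambda>x. f (x + c)) \<longleftrightarrow> integrable lborel f"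
    using integrable_distr_eq[OF plus f] by (simp add: lborel_distr_plus add.commute)
  show "(LINT x|lborel. f (x + c)) = (LINT x|lborel. f x)"
    using integral_distr[OF plus f] by (simp add: lborel_distr_plus add.commute)
qed

lemma integral_segment_average:
  fixes g :: "'a::euclidean_space \<Rightarrow> 'b::{banach, second_countable_topology}"
  assumes g: "integrable lborel g"
  shows "(LINT x|lborel. LINT t|lborel. indicator {0..1} t *\<^sub>R g (x + t *\<^sub>R u)) = (LINT x|lborel. g x)"
proof -
  have [measurable]: "g \<in> borel_measurable borel"
    using g by auto
  note translate = lborel_integral_translate[where f = "\<lambda>x. norm (g x)"]
  have int: "integrable (lborel \<Otimes>\<^sub>M lborel) (\<lambda>(t, x). indicator {0..1} t *\<^sub>R g (x + t *\<^sub>R u))"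
    using g by (intro lborel_pair.Fubini_integrable) (auto simp: lborel_integrable_translate translate)
  have "(LINT x|lborel. LINT t|lborel. indicator {0..1} t *\<^sub>R g (x + t *\<^sub>R u))
      = (LINT t|lborel. LINT x|lborel. indicator {0..1} t *\<^sub>R g (x + t *\<^sub>R u))"
    by (rule lborel_pair.Fubini_integral[OF int])
  also have "\<dots> = (LINT x|lborel. g x)"
    by (simp add: lborel_integral_translate)
  finally show ?thesis .
qed

text \<open>By translation invariance \<open>f (x + u) - f x = \<integral>\<^sub>0\<^sup>1 f' (x + t u) u dt\<close> integrates both to 0 and to
  the integral of the directional derivative.\<close>
lemma integral_directional_derivative_eq_0:
  fixes f :: "'a::euclidean_space \<Rightarrow> 'b::euclidean_space"
  assumes deriv: "\<And>x. (f has_derivative f' x) (at x)"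
    and cont: "continuous_on UNIV (\<lambda>x. f' x u)"
    and int: "integrable lborel f" "integrable lborel (\<lambda>x. f' x u)"
  shows "(LINT x|lborel. f' x u) = 0"
proof -
  have f: "f \<in> borel_measurable borel"
    using int(1) by auto
  have "((\<lambda>t. f (x + t *\<^sub>R u)) has_vector_derivative f' (x + t *\<^sub>R u) u) (at t within T)"
    for x t T
  proof -
    interpret f': bounded_linear "f' (x + t *\<^sub>R u)"
      using deriv by (rule has_derivative_bounded_linear)
    have "((\<lambda>t. x + t *\<^sub>R u) has_derivative (\<lambda>h. h *\<^sub>R u)) (at t within T)"
      by (auto intro!: derivative_eq_intros)
    from has_derivative_compose[OF this deriv] show ?thesis
      by (simp add: has_vector_derivative_def f'.scaleR)
  qed
  moreover have "continuous_on {0..1} (\<lambda>t. f' (x + t *\<^sub>R u) u)" for x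
    by (rule continuous_on_compose2[OF cont]) (auto intro!: continuous_intros)
  ultimately have "has_bochner_integral lborel (\<lambda>t. indicator {0..1} t *\<^sub>R f' (x + t *\<^sub>R u) u)
      (f (x + u) - f x)" for x
    using has_bochner_integral_FTC_Icc[of 0 1 "\<lambda>t. f (x + t *\<^sub>R u)"] by simp
  then have "(LINT x|lborel. f' x u) = (LINT x|lborel. f (x + u) - f x)"
    using integral_segment_average[OF int(2), of u] by (simp add: has_bochner_integral_iff)
  also have "\<dots> = 0"
    using int(1) f by (simp add: lborel_integrable_translate lborel_integral_translate)
  finally show ?thesis .
qed

lemma has_bochner_integral_exp_neg_norm_sq:
  fixes b :: real
  assumes "0 < b"
  shows "has_bochner_integral lborel (\<lambda>x::'a::euclidean_space. exp (- b * (norm x)\<^sup>2))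
    (sqrt (pi / b) ^ DIM('a))"
proof (rule has_bochner_integral_nn_integral)
  define s where "s = 1 / sqrt (2 * b)"
  have s: "0 < s" "2 * s\<^sup>2 = 1 / b"
    using assms by (auto simp: s_def power_divide)
  have density: "exp (- b * t\<^sup>2) = sqrt (pi / b) * normal_density 0 s t" for t
  proof -
    have "- (t - 0)\<^sup>2 / (2 * s\<^sup>2) = - b * t\<^sup>2" using s(2) by simp
    moreover have "2 * pi * s\<^sup>2 = pi / b" using s(2) by (simp add: mult.assoc mult.left_commute)
    ultimately show ?thesis using assms by (simp add: normal_density_def)
  qed
  have "(\<integral>\<^sup>+t. normal_density 0 s t \<partial>lborel) = 1"
    using s(1) by (simp add: nn_integral_eq_integral)
  then have "(\<integral>\<^sup>+t. ennreal (exp (- b * t\<^sup>2)) \<partial>lborel) = ennreal (sqrt (pi / b))"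
    using assms unfolding density by (simp add: ennreal_mult nn_integral_cmult)
  moreover have "exp (- b * (norm x)\<^sup>2) = (\<Prod>e\<in>Basis. exp (- b * (inner x e)\<^sup>2))" for x :: 'a
    unfolding power2_norm_eq_inner euclidean_inner[of x x]
    by (simp add: power2_eq_square sum_distrib_left flip: exp_sum)
  ultimately show "(\<integral>\<^sup>+(x::'a). ennreal (exp (- b * (norm x)\<^sup>2)) \<partial>lborel)
      = ennreal (sqrt (pi / b) ^ DIM('a))"
    using nn_integral_lborel_prod[where f = "\<lambda>_::'a. \<lambda>t. exp (- b * t\<^sup>2)"] assms
    by (simp add: prod_ennreal flip: ennreal_power)
qed (use assms in auto)

subsection \<open>Stein's identity in the plane\<close>

lemma integral_wirtinger_derivative_eq_0:
  fixes f P Q :: "complex \<Rightarrow> complex"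
  assumes deriv: "\<And>z. (f has_derivative (\<lambda>h. P z * h + Q z * cnj h)) (at z)"
    and cont: "continuous_on UNIV P" "continuous_on UNIV Q"
    and int: "integrable lborel f" "integrable lborel P" "integrable lborel Q"
  shows "(LINT z|lborel. Q z) = 0"
proof -
  have "(LINT z|lborel. P z) * u + (LINT z|lborel. Q z) * cnj u = 0" for u
    using integral_directional_derivative_eq_0[OF deriv, where u = u] cont int
    by (simp add: continuous_intros)
  from this[of 1] this[of \<i>] show ?thesis
    by (simp flip: right_diff_distrib add: mult.commute[of _ \<i>])
qed

lemma power_le_fact_mult_exp:
  fixes r :: real
  assumes "0 \<le> r"
  shows "r ^ N \<le> fact N * exp r"
proof -
  have "(\<Sum>n\<in>{N}. r ^ n /\<^sub>R fact n) \<le> exp r"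
    unfolding exp_def by (rule sum_le_suminf) (use assms summable_exp_generic[of r] in auto)
  then show ?thesis
    by (simp add: field_simps)
qed

lemma power_mult_exp_le_gaussian:
  fixes b K r :: real
  assumes "0 < b" "0 \<le> r"
  shows "r ^ N * exp (K * r - b * r\<^sup>2) \<le> fact N * exp ((K + 1)\<^sup>2 / (2 * b)) * exp (- (b / 2) * r\<^sup>2)"
proof -
  have "0 \<le> (K + 1 - b * r)\<^sup>2 / (2 * b)" using assms by simp
  also have "\<dots> = (K + 1)\<^sup>2 / (2 * b) - (K + 1) * r + b / 2 * r\<^sup>2"
    using assms by (simp add: power2_eq_square field_simps)
  finally have exponent: "r + (K * r - b * r\<^sup>2) \<le> (K + 1)\<^sup>2 / (2 * b) + - (b / 2) * r\<^sup>2"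
    by (simp add: algebra_simps)
  have "r ^ N * exp (K * r - b * r\<^sup>2) \<le> fact N * exp r * exp (K * r - b * r\<^sup>2)"
    using power_le_fact_mult_exp[OF assms(2)] by (intro mult_right_mono) auto
  also have "\<dots> = fact N * exp (r + (K * r - b * r\<^sup>2))"
    by (simp only: exp_add mult.assoc)
  also have "\<dots> \<le> fact N * exp ((K + 1)\<^sup>2 / (2 * b) + - (b / 2) * r\<^sup>2)"
    using exponent by simp
  finally show ?thesis by (simp only: exp_add mult.assoc)
qed

definition gaussian_monomial :: "real \<Rightarrow> complex \<Rightarrow> nat \<Rightarrow> nat \<Rightarrow> complex \<Rightarrow> complex" where
  "gaussian_monomial b c n m z =
     z ^ n * cnj z ^ m * exp (- (of_real b * (z * cnj z) + c * cnj z + cnj c * z))"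

lemma continuous_on_gaussian_monomial [continuous_intros]:
  "continuous_on A (gaussian_monomial b c n m)"
  unfolding gaussian_monomial_def[abs_def] by (intro continuous_intros)

lemma measurable_gaussian_monomial [measurable]:
  "gaussian_monomial b c n m \<in> borel_measurable borel"
  using continuous_on_gaussian_monomial by (rule borel_measurable_continuous_onI)

lemma gaussian_monomial_bound:
  assumes "0 < b"
  shows "norm (gaussian_monomial b c n m z)
    \<le> fact (n + m) * exp ((2 * norm c + 1)\<^sup>2 / (2 * b)) * exp (- (b / 2) * (norm z)\<^sup>2)"
proof -
  have "Re (- (of_real b * (z * cnj z) + c * cnj z + cnj c * z))
      = - b * (norm z)\<^sup>2 - 2 * Re (c * cnj z)"
    by (simp add: cmod_power2) (simp add: algebra_simps power2_eq_square)
  also have "\<dots> \<le> 2 * norm c * norm z - b * (norm z)\<^sup>2"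
    using abs_Re_le_cmod[of "c * cnj z"] by (simp add: norm_mult)
  finally have "norm (gaussian_monomial b c n m z)
      \<le> norm z ^ (n + m) * exp (2 * norm c * norm z - b * (norm z)\<^sup>2)"
    unfolding gaussian_monomial_def
    by (simp add: norm_mult norm_power power_add mult_left_mono)
  also have "\<dots> \<le> fact (n + m) * exp ((2 * norm c + 1)\<^sup>2 / (2 * b)) * exp (- (b / 2) * (norm z)\<^sup>2)"
    using assms by (intro power_mult_exp_le_gaussian) auto
  finally show ?thesis .
qed

lemma integrable_gaussian_monomial:
  assumes "0 < b"
  shows "integrable lborel (gaussian_monomial b c n m)"
proof (rule Bochner_Integration.integrable_bound)
  show "integrable lborel (\<lambda>z::complex. fact (n + m) * exp ((2 * norm c + 1)\<^sup>2 / (2 * b))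
      * exp (- (b / 2) * (norm z)\<^sup>2))"
    using has_bochner_integral_exp_neg_norm_sq[of "b / 2"] assms
    by (auto simp: has_bochner_integral_iff)
  show "AE z in lborel. norm (gaussian_monomial b c n m z) \<le> norm (fact (n + m)
      * exp ((2 * norm c + 1)\<^sup>2 / (2 * b)) * exp (- (b / 2) * (norm z)\<^sup>2))"
    using gaussian_monomial_bound[OF assms] by simp
qed simp

lemma has_derivative_gaussian_monomial:
  "(gaussian_monomial b c n m has_derivative
     (\<lambda>h. (of_nat n * gaussian_monomial b c (n - 1) m z
            - of_real b * gaussian_monomial b c n (Suc m) z - cnj c * gaussian_monomial b c n m z) * h
        + (of_nat m * gaussian_monomial b c n (m - 1) z
            - of_real b * gaussian_monomial b c (Suc n) m z - c * gaussian_monomial b c n m z) * cnj h)) (at z)"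
proof -
  let ?q = "\<lambda>z. - (of_real b * (z * cnj z) + c * cnj z + cnj c * z)"
  note cnj = bounded_linear.has_derivative[OF bounded_linear_cnj]
  have "(?q has_derivative
      (\<lambda>h. - (of_real b * (z * cnj h + h * cnj z) + c * cnj h + cnj c * h))) (at z)"
    by (auto intro!: derivative_eq_intros cnj)
  from has_derivative_compose[OF this DERIV_exp[unfolded has_field_derivative_def]]
  have exp: "((\<lambda>z. exp (?q z)) has_derivative
      (\<lambda>h. exp (?q z) * - (of_real b * (z * cnj h + h * cnj z) + c * cnj h + cnj c * h))) (at z)" .
  have "((\<lambda>z. z ^ n * cnj z ^ m) has_derivative
      (\<lambda>h. of_nat n * h * z ^ (n - 1) * cnj z ^ m
        + z ^ n * (of_nat m * cnj h * cnj z ^ (m - 1)))) (at z)"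
    by (auto intro!: derivative_eq_intros cnj simp: algebra_simps)
  from has_derivative_mult[OF this exp] show ?thesis
    unfolding gaussian_monomial_def[abs_def]
    by (rule has_derivative_eq_rhs) (simp add: fun_eq_iff algebra_simps)
qed

lemma integral_gaussian_monomial_stein:
  assumes "0 < b"
  shows "of_nat m * (LINT z|lborel. gaussian_monomial b c n (m - 1) z)
    = of_real b * (LINT z|lborel. gaussian_monomial b c (Suc n) m z)
      + c * (LINT z|lborel. gaussian_monomial b c n m z)"
proof -
  have "(LINT z|lborel. of_nat m * gaussian_monomial b c n (m - 1) z
      - of_real b * gaussian_monomial b c (Suc n) m z - c * gaussian_monomial b c n m z) = 0"
    by (rule integral_wirtinger_derivative_eq_0[OF has_derivative_gaussian_monomial])
       (intro continuous_intros Bochner_Integration.integrable_diff integrable_mult_right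
         integrable_gaussian_monomial assms)+
  then show ?thesis
    using assms by (simp add: integrable_gaussian_monomial diff_diff_eq)
qed

lemma integral_gaussian_monomial_0:
  assumes "0 < b"
  shows "(LINT z|lborel. gaussian_monomial b c 0 0 z)
    = of_real (pi / b) * exp (c * cnj c / of_real b)"
proof -
  have "gaussian_monomial b c 0 0 z
      = exp (c * cnj c / of_real b) * of_real (exp (- b * (norm (z + c / of_real b))\<^sup>2))" for z
  proof -
    have "c * cnj c / of_real b - of_real b * ((z + c / of_real b) * cnj (z + c / of_real b))
        = - (of_real b * (z * cnj z) + c * cnj z + cnj c * z)"
      using assms by (simp add: divide_simps) (simp add: algebra_simps)
    then show ?thesis
      by (simp add: gaussian_monomial_def complex_norm_square mult_exp_exp
          flip: exp_of_real del: of_real_power)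
  qed
  moreover have "(LINT z|lborel. exp (- b * (norm (z + c / of_real b))\<^sup>2)) = pi / b"
    using assms has_bochner_integral_integral_eq
      [OF has_bochner_integral_exp_neg_norm_sq[where 'a = complex, OF assms]]
    by (subst lborel_integral_translate) (simp_all add: power2_eq_square)
  ultimately show ?thesis
    by (simp add: mult.commute)
qed

subsection \<open>Positive definite forms\<close>

definition sesq_form ::
  "'i set \<Rightarrow> ('i \<Rightarrow> 'i \<Rightarrow> complex) \<Rightarrow> ('i \<Rightarrow> complex) \<Rightarrow> ('i \<Rightarrow> complex) \<Rightarrow> complex" where
  "sesq_form I A u v = (\<Sum>i\<in>I. cnj (u i) * (\<Sum>j\<in>I. A i j * v j))"

lemma sesq_form_diff_left:
  "sesq_form I A (\<lambda>i. u i - t * u' i) v = sesq_form I A u v - cnj t * sesq_form I A u' v"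
  by (simp add: sesq_form_def left_diff_distrib sum_subtractf sum_distrib_left mult.assoc)

lemma sesq_form_diff_right:
  "sesq_form I A u (\<lambda>i. v i - t * v' i) = sesq_form I A u v - t * sesq_form I A u v'"
  by (simp add: sesq_form_def right_diff_distrib sum_subtractf sum_distrib_left mult_ac)

lemma sesq_form_unit_left:
  assumes "finite I" "k \<in> I"
  shows "sesq_form I A (\<lambda>i. of_bool (i = k)) v = (\<Sum>j\<in>I. A k j * v j)"
proof -
  have "cnj (of_bool b) = of_bool b" for b
    by (cases b) auto
  then show ?thesis
    using assms by (simp add: sesq_form_def)
qed

lemma sesq_form_unit_unit:
  assumes "finite I" "k \<in> I" "l \<in> I"
  shows "sesq_form I A (\<lambda>i. of_bool (i = k)) (\<lambda>i. of_bool (i = l)) = A k l"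
  using assms by (simp add: sesq_form_unit_left)

locale pos_def_form =
  fixes I :: "'i set" and S :: "'i \<Rightarrow> 'i \<Rightarrow> complex"
  assumes finite_index: "finite I"
    and herm: "\<And>i j. i \<in> I \<Longrightarrow> j \<in> I \<Longrightarrow> cnj (S i j) = S j i"
    and pos: "\<And>v i. i \<in> I \<Longrightarrow> v i \<noteq> 0 \<Longrightarrow> 0 < Re (sesq_form I S v v)"
begin

lemma cnj_sesq_form: "cnj (sesq_form I S u v) = sesq_form I S v u"
proof -
  have "cnj (sesq_form I S u v) = (\<Sum>i\<in>I. \<Sum>j\<in>I. u i * (cnj (S i j) * cnj (v j)))"
    by (simp add: sesq_form_def sum_distrib_left)
  also have "\<dots> = (\<Sum>i\<in>I. \<Sum>j\<in>I. cnj (v j) * (S j i * u i))"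
    by (intro sum.cong refl) (simp add: herm)
  also have "\<dots> = sesq_form I S v u"
    unfolding sesq_form_def sum_distrib_left by (rule sum.swap)
  finally show ?thesis .
qed

lemma sesq_form_self_real: "sesq_form I S v v = of_real (Re (sesq_form I S v v))"
  using cnj_sesq_form[of v v] by (simp add: complex_eq_iff)

lemma sesq_form_self_nonneg: "0 \<le> Re (sesq_form I S v v)"
proof (cases "\<exists>i\<in>I. v i \<noteq> 0")
  case True
  then show ?thesis using pos less_imp_le by blast
next
  case False
  then show ?thesis by (simp add: sesq_form_def)
qed

lemma diag:
  assumes "k \<in> I"
  shows diag_real: "S k k = of_real (Re (S k k))" and diag_pos: "0 < Re (S k k)"
  using sesq_form_self_real[of "\<lambda>i. of_bool (i = k)"] pos[OF assms, of "\<lambda>i. of_bool (i = k)"]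
  by (simp_all add: sesq_form_unit_unit finite_index assms)

lemma cauchy_schwarz:
  "(norm (sesq_form I S u v))\<^sup>2 \<le> Re (sesq_form I S u u) * Re (sesq_form I S v v)"
proof (cases "\<exists>i\<in>I. u i \<noteq> 0")
  case True
  define a where "a = Re (sesq_form I S u u)"
  have a: "0 < a" "sesq_form I S u u = of_real a"
    using True pos sesq_form_self_real by (auto simp: a_def)
  define t where "t = sesq_form I S u v / of_real a"
  define w where "w i = v i - t * u i" for i
  have "sesq_form I S w w = sesq_form I S v v - t * cnj (sesq_form I S u v)
      - cnj t * (sesq_form I S u v - t * of_real a)"
    unfolding w_def
    by (simp add: sesq_form_diff_left sesq_form_diff_right cnj_sesq_form a(2) algebra_simps)
  also have "\<dots> = sesq_form I S v v - of_real ((norm (sesq_form I S u v))\<^sup>2 / a)"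
    using a(1) by (simp add: t_def complex_norm_square[symmetric] del: of_real_power)
  finally have "0 \<le> Re (sesq_form I S v v) - (norm (sesq_form I S u v))\<^sup>2 / a"
    using sesq_form_self_nonneg[of w] by simp
  then show ?thesis
    using a(1) unfolding a_def[symmetric] by (simp add: field_simps)
next
  case False
  then show ?thesis by (simp add: sesq_form_def)
qed

lemma cnj_row_sum:
  assumes "k \<in> I" "J \<subseteq> I"
  shows "cnj (\<Sum>j\<in>J. S k j * x j) = (\<Sum>i\<in>J. cnj (x i) * S i k)"
  unfolding cnj_sum using assms by (intro sum.cong refl) (auto simp: herm)

lemma sesq_form_fun_upd:
  assumes k: "k \<in> I"
  defines "c x \<equiv> \<Sum>j\<in>I - {k}. S k j * x j"
  shows "sesq_form I S (x(k := y)) (x(k := y))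
    = of_real (Re (S k k)) * (y * cnj y) + c x * cnj y + cnj (c x) * y + sesq_form (I - {k}) S x x"
proof -
  have split: "(\<Sum>i\<in>I. f i) = f k + (\<Sum>i\<in>I - {k}. f i)" for f :: "'i \<Rightarrow> complex"
    using finite_index k by (rule sum.remove)
  have rest: "(\<Sum>j\<in>I - {k}. S i j * (x(k := y)) j) = (\<Sum>j\<in>I - {k}. S i j * x j)"
    "(\<Sum>i\<in>I - {k}. cnj ((x(k := y)) i) * f i) = (\<Sum>i\<in>I - {k}. cnj (x i) * f i)" for i f
    by (auto intro: sum.cong)
  have cnj_c: "cnj (c x) * y = (\<Sum>i\<in>I - {k}. cnj (x i) * (S i k * y))"
    unfolding c_def cnj_row_sum[OF k Diff_subset] sum_distrib_right by (simp only: mult.assoc)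
  have "sesq_form I S (x(k := y)) (x(k := y)) = cnj y * (S k k * y + c x)
      + (\<Sum>i\<in>I - {k}. cnj (x i) * (S i k * y + (\<Sum>j\<in>I - {k}. S i j * x j)))"
    unfolding sesq_form_def split rest by (simp add: c_def)
  also have "\<dots> = S k k * (y * cnj y) + c x * cnj y + cnj (c x) * y + sesq_form (I - {k}) S x x"
    unfolding sesq_form_def distrib_left sum.distrib cnj_c by (simp add: mult_ac)
  finally show ?thesis
    using diag_real[OF k] by simp
qed

end

locale pos_def_inverse = pos_def_form I S for I :: "'i set" and S +
  fixes B :: "'i \<Rightarrow> 'i \<Rightarrow> complex"
  assumes right_inverse: "\<And>i j. i \<in> I \<Longrightarrow> j \<in> I \<Longrightarrow> (\<Sum>k\<in>I. S i k * B k j) = of_bool (i = j)"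
begin

definition solution :: "('i \<Rightarrow> complex) \<Rightarrow> 'i \<Rightarrow> complex" where
  "solution z i = (\<Sum>j\<in>I. B i j * z j)"

lemma mult_solution:
  assumes "i \<in> I"
  shows "(\<Sum>j\<in>I. S i j * solution z j) = z i"
proof -
  have "(\<Sum>j\<in>I. S i j * solution z j) = (\<Sum>l\<in>I. (\<Sum>j\<in>I. S i j * B j l) * z l)"
    unfolding solution_def sum_distrib_left sum_distrib_right
    by (subst sum.swap) (simp add: mult.assoc)
  also have "\<dots> = (\<Sum>l\<in>I. of_bool (i = l) * z l)"
    using assms by (simp add: right_inverse)
  also have "\<dots> = z i"
    using assms finite_index by simp
  finally show ?thesis .
qed

lemma sesq_form_inverse: "sesq_form I B u v = sesq_form I S (solution u) (solution v)"
proof -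
  have "sesq_form I S (solution v) (solution u) = (\<Sum>i\<in>I. cnj (solution v i) * u i)"
    by (simp add: sesq_form_def mult_solution)
  also have "\<dots> = cnj (sesq_form I B u v)"
    by (simp add: sesq_form_def solution_def mult.commute)
  finally show ?thesis
    using cnj_sesq_form[of "solution v" "solution u"] by simp
qed

sublocale inv: pos_def_form I B
proof
  have cnj_sesq_form_B: "cnj (sesq_form I B u v) = sesq_form I B v u" for u v
    by (simp only: sesq_form_inverse cnj_sesq_form)
  show "cnj (B i j) = B j i" if "i \<in> I" "j \<in> I" for i j
    using cnj_sesq_form_B[of "\<lambda>l. of_bool (l = i)" "\<lambda>l. of_bool (l = j)"] that
    by (simp add: sesq_form_unit_unit finite_index)
  show "0 < Re (sesq_form I B z z)" if i: "i \<in> I" "z i \<noteq> 0" for z i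
  proof -
    have "\<exists>j\<in>I. solution z j \<noteq> 0"
    proof (rule ccontr)
      assume "\<not> ?thesis"
      then have "(\<Sum>j\<in>I. S i j * solution z j) = 0" by simp
      then show False using mult_solution[OF i(1)] i(2) by simp
    qed
    then show ?thesis
      unfolding sesq_form_inverse using pos by blast
  qed
qed (rule finite_index)

lemma norm_sq_le_sesq_form_inverse:
  assumes "k \<in> I"
  shows "(norm (z k))\<^sup>2 \<le> Re (S k k) * Re (sesq_form I B z z)"
  using cauchy_schwarz[of "\<lambda>i. of_bool (i = k)" "solution z"] assms
  by (simp add: sesq_form_unit_unit sesq_form_unit_left mult_solution finite_index
      flip: sesq_form_inverse)

lemma sesq_form_inverse_lower_bound:
  "(\<Sum>k\<in>I. (norm (z k))\<^sup>2 / (card I * Re (S k k))) \<le> Re (sesq_form I B z z)"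
proof (cases "I = {}")
  case False
  then have card: "0 < card I" using finite_index by (simp add: card_gt_0_iff)
  have "(\<Sum>k\<in>I. (norm (z k))\<^sup>2 / (card I * Re (S k k))) \<le> (\<Sum>k\<in>I. Re (sesq_form I B z z) / card I)"
  proof (rule sum_mono)
    fix k assume "k \<in> I"
    then show "(norm (z k))\<^sup>2 / (card I * Re (S k k)) \<le> Re (sesq_form I B z z) / card I"
      using norm_sq_le_sesq_form_inverse[of k z] diag_pos[of k] card by (simp add: field_simps)
  qed
  then show ?thesis using card by simp
qed (simp add: sesq_form_def)

end

subsection \<open>Moments of a Gaussian weight\<close>

abbreviation incr :: "'i \<Rightarrow> ('i \<Rightarrow> nat) \<Rightarrow> 'i \<Rightarrow> nat" where
  "incr k n \<equiv> n(k := Suc (n k))"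

abbreviation decr :: "'i \<Rightarrow> ('i \<Rightarrow> nat) \<Rightarrow> 'i \<Rightarrow> nat" where
  "decr k n \<equiv> n(k := n k - 1)"

abbreviation lborel_C :: "'i set \<Rightarrow> ('i \<Rightarrow> complex) measure" where
  "lborel_C I \<equiv> Pi\<^sub>M I (\<lambda>_. lborel)"

interpretation lborel_C: product_sigma_finite "\<lambda>_. lborel :: complex measure" ..

lemma integral_lborel_C_split:
  fixes f :: "('i \<Rightarrow> complex) \<Rightarrow> complex"
  assumes "finite I" "k \<in> I" "integrable (lborel_C I) f"
  shows "(LINT z|lborel_C I. f z) = (LINT x|lborel_C (I - {k}). LINT y|lborel. f (x(k := y)))"
  using lborel_C.product_integral_insert[of "I - {k}" k f] assms by (simp add: insert_absorb)

definition gaussian_integrand ::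
  "'i set \<Rightarrow> ('i \<Rightarrow> 'i \<Rightarrow> complex) \<Rightarrow> ('i \<Rightarrow> nat) \<Rightarrow> ('i \<Rightarrow> nat) \<Rightarrow> ('i \<Rightarrow> complex) \<Rightarrow> complex" where
  "gaussian_integrand I B n m z = (\<Prod>j\<in>I. z j ^ n j * cnj (z j) ^ m j) * exp (- sesq_form I B z z)"

definition gaussian_moment ::
  "'i set \<Rightarrow> ('i \<Rightarrow> 'i \<Rightarrow> complex) \<Rightarrow> ('i \<Rightarrow> nat) \<Rightarrow> ('i \<Rightarrow> nat) \<Rightarrow> complex" where
  "gaussian_moment I B n m = (LINT z|lborel_C I. gaussian_integrand I B n m z)"

lemma measurable_gaussian_integrand [measurable]:
  "gaussian_integrand I B n m \<in> borel_measurable (lborel_C I)"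
proof -
  have [measurable]: "cnj \<in> borel_measurable borel"
    by (intro borel_measurable_continuous_onI continuous_intros)
  have [measurable]: "(\<lambda>z. z i) \<in> borel_measurable (lborel_C I)" if "i \<in> I" for i
    using measurable_component_singleton[OF that, of "\<lambda>_. lborel :: complex measure"] by simp
  show ?thesis
    unfolding gaussian_integrand_def[abs_def] sesq_form_def by measurable
qed

lemma gaussian_integrand_incr:
  assumes "finite I" "j \<in> I"
  shows "gaussian_integrand I B (incr j n) m z = z j * gaussian_integrand I B n m z"
proof -
  have "(\<Prod>i\<in>I - {j}. z i ^ incr j n i * cnj (z i) ^ m i)
      = (\<Prod>i\<in>I - {j}. z i ^ n i * cnj (z i) ^ m i)"
    by (intro prod.cong) auto
  then show ?thesis
    using assms unfolding gaussian_integrand_def by (simp add: prod.remove[of I j] mult_ac)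
qed

lemma gaussian_integrand_cong:
  assumes "\<And>i. i \<in> I \<Longrightarrow> n i = n' i" "\<And>i. i \<in> I \<Longrightarrow> m i = m' i"
  shows "gaussian_integrand I B n m z = gaussian_integrand I B n' m' z"
  using assms by (simp add: gaussian_integrand_def)

context pos_def_inverse
begin

lemma gaussian_integrand_fun_upd:
  assumes k: "k \<in> I"
  shows "gaussian_integrand I B n m (x(k := y)) = gaussian_integrand (I - {k}) B n m x
    * gaussian_monomial (Re (B k k)) (\<Sum>j\<in>I - {k}. B k j * x j) (n k) (m k) y"
proof -
  define b c where "b = Re (B k k)" and "c = (\<Sum>j\<in>I - {k}. B k j * x j)"
  have "(\<Prod>j\<in>I - {k}. (x(k := y)) j ^ n j * cnj ((x(k := y)) j) ^ m j)
      = (\<Prod>j\<in>I - {k}. x j ^ n j * cnj (x j) ^ m j)"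
    by (intro prod.cong) auto
  then have monomial: "(\<Prod>j\<in>I. (x(k := y)) j ^ n j * cnj ((x(k := y)) j) ^ m j)
      = y ^ n k * cnj y ^ m k * (\<Prod>j\<in>I - {k}. x j ^ n j * cnj (x j) ^ m j)"
    using k finite_index by (simp add: prod.remove[of I k])
  have exponential: "exp (- sesq_form I B (x(k := y)) (x(k := y)))
      = exp (- (of_real b * (y * cnj y) + c * cnj y + cnj c * y))
        * exp (- sesq_form (I - {k}) B x x)"
    unfolding inv.sesq_form_fun_upd[OF k] b_def c_def by (simp only: mult_exp_exp minus_add_distrib)
  show ?thesis
    unfolding gaussian_integrand_def monomial exponential gaussian_monomial_def
      b_def[symmetric] c_def[symmetric]
    by (simp only: mult_ac)
qed

lemma integrable_gaussian_integrand: "integrable (lborel_C I) (gaussian_integrand I B n m)"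
proof (rule Bochner_Integration.integrable_bound)
  define rate where "rate k = 1 / (card I * Re (S k k))" for k
  have rate: "0 < rate k" if "k \<in> I" for k
  proof -
    have "0 < card I"
      using that finite_index by (auto simp: card_gt_0_iff)
    then show ?thesis
      using diag_pos[OF that] by (simp add: rate_def)
  qed
  show "integrable (lborel_C I) (\<lambda>z. \<Prod>k\<in>I. gaussian_monomial (rate k) 0 (n k) (m k) (z k))"
    by (intro lborel_C.product_integrable_prod integrable_gaussian_monomial rate finite_index)
  have "norm (gaussian_integrand I B n m z)
      \<le> norm (\<Prod>k\<in>I. gaussian_monomial (rate k) 0 (n k) (m k) (z k))" for z
  proof -
    have "norm (gaussian_monomial (rate k) 0 (n k) (m k) (z k))
        = norm (z k ^ n k * cnj (z k) ^ m k)
          * exp (- ((norm (z k))\<^sup>2 / (card I * Re (S k k))))" for k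
      by (simp add: gaussian_monomial_def rate_def norm_mult complex_norm_square[symmetric]
          del: of_real_power)
    then have "norm (\<Prod>k\<in>I. gaussian_monomial (rate k) 0 (n k) (m k) (z k))
        = norm (\<Prod>k\<in>I. z k ^ n k * cnj (z k) ^ m k)
          * exp (- (\<Sum>k\<in>I. (norm (z k))\<^sup>2 / (card I * Re (S k k))))"
      unfolding prod_norm[symmetric] sum_negf[symmetric] exp_sum[OF finite_index]
        prod.distrib[symmetric] by simp
    then show ?thesis
      using sesq_form_inverse_lower_bound[of z]
      by (simp add: gaussian_integrand_def norm_mult mult_left_mono)
  qed
  then show "AE z in lborel_C I. norm (gaussian_integrand I B n m z)
      \<le> norm (\<Prod>k\<in>I. gaussian_monomial (rate k) 0 (n k) (m k) (z k))" by simp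
qed measurable

lemma cnj_gaussian_moment: "cnj (gaussian_moment I B n m) = gaussian_moment I B m n"
proof -
  have "cnj (gaussian_integrand I B n m z) = gaussian_integrand I B m n z" for z
    by (simp add: gaussian_integrand_def exp_cnj inv.cnj_sesq_form mult.commute)
  then show ?thesis
    unfolding gaussian_moment_def Bochner_Integration.integral_cnj[symmetric] by (simp only:)
qed

lemma integral_gaussian_integrand_stein:
  assumes k: "k \<in> I"
  shows "(LINT y|lborel. (\<Sum>j\<in>I. B k j * gaussian_integrand I B (incr j n) m (x(k := y))))
    = (LINT y|lborel. of_nat (m k) * gaussian_integrand I B n (decr k m) (x(k := y)))"
proof -
  define b c where "b = Re (B k k)" and "c = (\<Sum>j\<in>I - {k}. B k j * x j)"
  define F where "F = gaussian_integrand (I - {k}) B n m x"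
  note diag = inv.diag[OF k, folded b_def]
  have linear: "(\<Sum>j\<in>I. B k j * (x(k := y)) j) = of_real b * y + c" for y
    using k finite_index diag(1) by (simp add: sum.remove[of I k] c_def)
  have "(\<Sum>j\<in>I. B k j * gaussian_integrand I B (incr j n) m (x(k := y)))
      = F * (of_real b * gaussian_monomial b c (Suc (n k)) (m k) y
          + c * gaussian_monomial b c (n k) (m k) y)" for y
  proof -
    have "(\<Sum>j\<in>I. B k j * gaussian_integrand I B (incr j n) m (x(k := y)))
        = (\<Sum>j\<in>I. B k j * (x(k := y)) j) * gaussian_integrand I B n m (x(k := y))"
      unfolding sum_distrib_right
      by (intro sum.cong refl) (simp add: gaussian_integrand_incr finite_index del: fun_upd_apply)
    also have "\<dots> = (of_real b * y + c) * (F * gaussian_monomial b c (n k) (m k) y)"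
      unfolding linear gaussian_integrand_fun_upd[OF k] b_def c_def F_def ..
    finally show ?thesis
      by (simp add: gaussian_monomial_def algebra_simps)
  qed
  then have "(LINT y|lborel. (\<Sum>j\<in>I. B k j * gaussian_integrand I B (incr j n) m (x(k := y))))
      = F * (of_nat (m k) * (LINT y|lborel. gaussian_monomial b c (n k) (m k - 1) y))"
    by (simp add: integrable_gaussian_monomial diag(2) integral_gaussian_monomial_stein[OF diag(2)]
        del: One_nat_def)
  also have "\<dots> = (LINT y|lborel. of_nat (m k) * gaussian_integrand I B n (decr k m) (x(k := y)))"
    using gaussian_integrand_cong[of "I - {k}" n n "decr k m" m B x]
    by (simp add: gaussian_integrand_fun_upd[OF k] b_def c_def F_def)
  finally show ?thesis .
qed

lemma gaussian_moment_stein: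
  assumes k: "k \<in> I"
  shows "(\<Sum>j\<in>I. B k j * gaussian_moment I B (incr j n) m)
    = of_nat (m k) * gaussian_moment I B n (decr k m)"
proof -
  have int: "integrable (lborel_C I) (\<lambda>z. c * gaussian_integrand I B n m z)" for c n m
    by (intro integrable_mult_right integrable_gaussian_integrand)
  have "(\<Sum>j\<in>I. B k j * gaussian_moment I B (incr j n) m)
      = (LINT z|lborel_C I. (\<Sum>j\<in>I. B k j * gaussian_integrand I B (incr j n) m z))"
    by (simp add: gaussian_moment_def int Bochner_Integration.integral_sum)
  also have "\<dots> = (LINT z|lborel_C I. of_nat (m k) * gaussian_integrand I B n (decr k m) z)"
    by (subst (1 2) integral_lborel_C_split[OF finite_index k])
       (auto intro!: Bochner_Integration.integrable_sum int
          simp only: integral_gaussian_integrand_stein[OF k])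
  also have "\<dots> = of_nat (m k) * gaussian_moment I B n (decr k m)"
    by (simp add: gaussian_moment_def)
  finally show ?thesis .
qed

lemma gaussian_moment_incr:
  assumes h: "h \<in> I"
  shows "gaussian_moment I B (incr h n) m
    = (\<Sum>k\<in>I. S h k * of_nat (m k) * gaussian_moment I B n (decr k m))"
proof -
  have "(\<Sum>k\<in>I. S h k * of_nat (m k) * gaussian_moment I B n (decr k m))
      = (\<Sum>k\<in>I. S h k * (\<Sum>j\<in>I. B k j * gaussian_moment I B (incr j n) m))"
    by (simp add: gaussian_moment_stein mult.assoc)
  also have "\<dots> = (\<Sum>j\<in>I. (\<Sum>k\<in>I. S h k * B k j) * gaussian_moment I B (incr j n) m)"
    unfolding sum_distrib_left sum_distrib_right by (subst sum.swap) (simp add: mult.assoc)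
  also have "\<dots> = gaussian_moment I B (incr h n) m"
    using h finite_index by (simp add: right_inverse)
  finally show ?thesis by simp
qed

end

subsection \<open>Normalisation\<close>

definition schur_complement :: "'i \<Rightarrow> ('i \<Rightarrow> 'i \<Rightarrow> complex) \<Rightarrow> 'i \<Rightarrow> 'i \<Rightarrow> complex" where
  "schur_complement k B i j = B i j - B i k * B k j / B k k"

context pos_def_inverse
begin

lemma pos_def_inverse_schur_complement:
  assumes k: "k \<in> I"
  shows "pos_def_inverse (I - {k}) S (schur_complement k B)"
proof (intro pos_def_inverse.intro pos_def_form.intro pos_def_inverse_axioms.intro)
  have B_kk: "B k k \<noteq> 0" using inv.diag_pos[OF k] by auto
  have minor: "(\<Sum>l\<in>I - {k}. S i l * B l j) = of_bool (i = j) - S i k * B k j"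
    if "i \<in> I" "j \<in> I" for i j
    using right_inverse[OF that] k finite_index by (simp add: sum.remove[of I k] algebra_simps)
  show "0 < Re (sesq_form (I - {k}) S v v)" if "i \<in> I - {k}" "v i \<noteq> 0" for v i
  proof -
    have "sesq_form (I - {k}) S v v = sesq_form I S (v(k := 0)) (v(k := 0))"
      by (simp add: sesq_form_fun_upd[OF k])
    also have "0 < Re \<dots>"
      using that by (intro pos[of i]) auto
    finally show ?thesis .
  qed
  show "(\<Sum>l\<in>I - {k}. S i l * schur_complement k B l j) = of_bool (i = j)"
    if "i \<in> I - {k}" "j \<in> I - {k}" for i j
  proof -
    have "(\<Sum>l\<in>I - {k}. S i l * schur_complement k B l j)
        = (\<Sum>l\<in>I - {k}. S i l * B l j) - (\<Sum>l\<in>I - {k}. S i l * B l k) * B k j / B k k"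
      by (simp add: schur_complement_def right_diff_distrib sum_subtractf sum_distrib_right
          sum_divide_distrib mult.assoc)
    also have "\<dots> = of_bool (i = j)"
      using that k B_kk by (simp add: minor)
    finally show ?thesis .
  qed
  show "cnj (S i j) = S j i" if "i \<in> I - {k}" "j \<in> I - {k}" for i j
    using that by (simp add: herm)
qed (simp add: finite_index)

lemma sesq_form_schur_complement:
  assumes k: "k \<in> I"
  defines "c x \<equiv> \<Sum>j\<in>I - {k}. B k j * x j"
  shows "sesq_form (I - {k}) (schur_complement k B) x x
    = sesq_form (I - {k}) B x x - c x * cnj (c x) / B k k"
proof -
  have cnj_c: "cnj (c x) = (\<Sum>i\<in>I - {k}. cnj (x i) * B i k)"
    unfolding c_def by (rule inv.cnj_row_sum[OF k Diff_subset])
  have "(\<Sum>j\<in>I - {k}. schur_complement k B i j * x j)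
      = (\<Sum>j\<in>I - {k}. B i j * x j) - B i k * (c x / B k k)" for i
    unfolding schur_complement_def c_def left_diff_distrib sum_subtractf sum_distrib_left
      sum_divide_distrib
    by (simp add: mult.assoc)
  then have "sesq_form (I - {k}) (schur_complement k B) x x
      = (\<Sum>i\<in>I - {k}. cnj (x i) * (\<Sum>j\<in>I - {k}. B i j * x j) - cnj (x i) * B i k * (c x / B k k))"
    by (simp add: sesq_form_def right_diff_distrib mult.assoc)
  also have "\<dots> = sesq_form (I - {k}) B x x - cnj (c x) * (c x / B k k)"
    unfolding cnj_c sum_distrib_right sum_subtractf sesq_form_def ..
  finally show ?thesis by (simp add: mult.commute)
qed

lemma integral_gaussian_integrand_0_fun_upd:
  assumes k: "k \<in> I"
  shows "(LINT y|lborel. gaussian_integrand I B (\<lambda>_. 0) (\<lambda>_. 0) (x(k := y)))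
    = pi / B k k * gaussian_integrand (I - {k}) (schur_complement k B) (\<lambda>_. 0) (\<lambda>_. 0) x"
proof -
  define b c where "b = Re (B k k)" and "c = (\<Sum>j\<in>I - {k}. B k j * x j)"
  note diag = inv.diag[OF k, folded b_def]
  have "(LINT y|lborel. gaussian_integrand I B (\<lambda>_. 0) (\<lambda>_. 0) (x(k := y)))
      = of_real (pi / b) * (exp (c * cnj c / of_real b) * exp (- sesq_form (I - {k}) B x x))"
    unfolding gaussian_integrand_fun_upd[OF k] b_def[symmetric] c_def[symmetric]
    by (simp add: integral_gaussian_monomial_0 diag(2) gaussian_integrand_def)
  also have "exp (c * cnj c / of_real b) * exp (- sesq_form (I - {k}) B x x)
      = exp (- sesq_form (I - {k}) (schur_complement k B) x x)"
    unfolding sesq_form_schur_complement[OF k] c_def[symmetric] diag(1) mult_exp_exp by simp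
  also have "of_real (pi / b) * \<dots>
      = pi / B k k * gaussian_integrand (I - {k}) (schur_complement k B) (\<lambda>_. 0) (\<lambda>_. 0) x"
    by (simp add: gaussian_integrand_def diag(1))
  finally show ?thesis .
qed

end

lemma det_mat_delete_last:
  fixes A B :: "'a::comm_ring_1 mat"
  assumes A: "A \<in> carrier_mat (Suc q) (Suc q)" and B: "B \<in> carrier_mat (Suc q) (Suc q)"
    and AB: "A * B = 1\<^sub>m (Suc q)"
  shows "Determinant.det (mat_delete A q q) = Determinant.det A * B $$ (q, q)"
proof -
  have "adj_mat A = adj_mat A * (A * B)"
    using adj_mat(1)[OF A] by (simp add: AB)
  also have "\<dots> = (Determinant.det A \<cdot>\<^sub>m 1\<^sub>m (Suc q)) * B"
    using assoc_mult_mat[OF adj_mat(1)[OF A] A B] adj_mat(3)[OF A] by simp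
  also have "\<dots> = Determinant.det A \<cdot>\<^sub>m B"
    using B by (simp add: mult_smult_assoc_mat[OF one_carrier_mat B])
  finally have "adj_mat A $$ (q, q) = Determinant.det A * B $$ (q, q)"
    using B by simp
  then show ?thesis
    using A by (simp add: adj_mat_def cofactor_def)
qed

lemma det_leading_minor:
  assumes "pos_def_inverse {..<Suc q} S B"
  shows "Determinant.det (mat (Suc q) (Suc q) (\<lambda>(i, j). S i j)) * B q q
    = Determinant.det (mat q q (\<lambda>(i, j). S i j))"
proof -
  interpret pos_def_inverse "{..<Suc q}" S B by fact
  let ?mat = "\<lambda>n (A :: nat \<Rightarrow> nat \<Rightarrow> complex). mat n n (\<lambda>(i, j). A i j)"
  have "?mat (Suc q) S * ?mat (Suc q) B = 1\<^sub>m (Suc q)"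
    using right_inverse by (intro eq_matI) (auto simp: scalar_prod_def atLeast0LessThan)
  moreover have "mat_delete (?mat (Suc q) S) q q = ?mat q S"
    by (intro eq_matI) (auto simp: mat_delete_def)
  ultimately show ?thesis
    using det_mat_delete_last[of "?mat (Suc q) S" q "?mat (Suc q) B"] by simp
qed

lemma gaussian_moment_0:
  assumes "pos_def_inverse {..<p} S B"
  shows "gaussian_moment {..<p} B (\<lambda>_. 0) (\<lambda>_. 0)
    = of_real pi ^ p * Determinant.det (mat p p (\<lambda>(i, j). S i j))"
  using assms
proof (induction p arbitrary: B)
  case 0
  show ?case
    unfolding gaussian_moment_def gaussian_integrand_def
    by (simp add: PiM_empty sesq_form_def lebesgue_integral_count_space_finite)
next
  case (Suc p)
  interpret pos_def_inverse "{..<Suc p}" S B by fact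
  let ?C = "schur_complement p B"
  have minor: "{..<Suc p} - {p} = {..<p}" by auto
  interpret schur: pos_def_inverse "{..<p}" S ?C
    using pos_def_inverse_schur_complement[of p] by (simp add: minor)
  have "gaussian_moment {..<Suc p} B (\<lambda>_. 0) (\<lambda>_. 0)
      = (LINT x|lborel_C {..<p}. pi / B p p * gaussian_integrand {..<p} ?C (\<lambda>_. 0) (\<lambda>_. 0) x)"
    unfolding gaussian_moment_def
    by (subst integral_lborel_C_split[of _ p])
       (simp_all add: integrable_gaussian_integrand integral_gaussian_integrand_0_fun_upd minor)
  also have "\<dots> = pi / B p p * gaussian_moment {..<p} ?C (\<lambda>_. 0) (\<lambda>_. 0)"
    unfolding gaussian_moment_def by (rule integral_mult_right_zero)
  also have "\<dots> = pi / B p p * (of_real pi ^ p * Determinant.det (mat p p (\<lambda>(i, j). S i j)))"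
    by (simp only: Suc.IH[OF schur.pos_def_inverse_axioms])
  also have "\<dots> = of_real pi ^ Suc p * Determinant.det (mat (Suc p) (Suc p) (\<lambda>(i, j). S i j))"
    using inv.diag_pos[of p] by (auto simp flip: det_leading_minor[OF Suc.prems])
  finally show ?case .
qed

subsection \<open>Contingency tables\<close>

definition contingency_tables ::
  "'i set \<Rightarrow> 'j set \<Rightarrow> ('i \<Rightarrow> nat) \<Rightarrow> ('j \<Rightarrow> nat) \<Rightarrow> ('i \<Rightarrow> 'j \<Rightarrow> nat) set" where
  "contingency_tables R C n m = {a. (\<forall>i j. i \<notin> R \<or> j \<notin> C \<longrightarrow> a i j = 0)
     \<and> (\<forall>i\<in>R. (\<Sum>j\<in>C. a i j) = n i) \<and> (\<forall>j\<in>C. (\<Sum>i\<in>R. a i j) = m j)}"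

definition table_weight ::
  "'i set \<Rightarrow> 'j set \<Rightarrow> ('i \<Rightarrow> 'j \<Rightarrow> 'a::field_char_0) \<Rightarrow> ('i \<Rightarrow> 'j \<Rightarrow> nat) \<Rightarrow> 'a" where
  "table_weight R C S a = (\<Prod>h\<in>R. \<Prod>k\<in>C. S h k ^ a h k / fact (a h k))"

abbreviation incr_entry :: "'i \<Rightarrow> 'j \<Rightarrow> ('i \<Rightarrow> 'j \<Rightarrow> nat) \<Rightarrow> 'i \<Rightarrow> 'j \<Rightarrow> nat" where
  "incr_entry h k a \<equiv> a(h := incr k (a h))"

abbreviation decr_entry :: "'i \<Rightarrow> 'j \<Rightarrow> ('i \<Rightarrow> 'j \<Rightarrow> nat) \<Rightarrow> 'i \<Rightarrow> 'j \<Rightarrow> nat" where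
  "decr_entry h k a \<equiv> a(h := decr k (a h))"

lemma sum_incr:
  assumes "finite A"
  shows "sum (incr k f) A = sum f A + of_bool (k \<in> A)"
proof -
  have "sum (incr k f) A = (\<Sum>i\<in>A. f i + of_bool (i = k))"
    by (intro sum.cong) auto
  then show ?thesis
    using assms by (simp add: sum.distrib)
qed

lemma prod_scale_one_factor:
  fixes f g :: "'a \<Rightarrow> 'b::comm_monoid_mult"
  assumes "finite A" "x \<in> A" "f x = c * g x" "\<And>i. i \<in> A \<Longrightarrow> i \<noteq> x \<Longrightarrow> f i = g i"
  shows "prod f A = c * prod g A"
proof -
  have "prod f (A - {x}) = prod g (A - {x})"
    using assms(4) by (intro prod.cong) auto
  then show ?thesis
    using assms(1-3) by (simp add: prod.remove[of A x] mult.assoc)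
qed

lemma prod_fact_incr:
  assumes "finite A" "k \<in> A"
  shows "(\<Prod>i\<in>A. fact (incr k n i)) = of_nat (Suc (n k)) * (\<Prod>i\<in>A. fact (n i) :: 'a::field_char_0)"
  using assms by (intro prod_scale_one_factor[where x = k]) auto

lemma contingency_tables_total:
  assumes "a \<in> contingency_tables R C n m"
  shows "sum n R = sum m C"
proof -
  have "sum n R = (\<Sum>i\<in>R. \<Sum>j\<in>C. a i j)" using assms by (simp add: contingency_tables_def)
  also have "\<dots> = (\<Sum>j\<in>C. \<Sum>i\<in>R. a i j)" by (rule sum.swap)
  also have "\<dots> = sum m C" using assms by (simp add: contingency_tables_def)
  finally show ?thesis .
qed

context
  fixes R :: "'i set" and C :: "'j set"
  assumes finite_rows: "finite R" and finite_cols: "finite C"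
begin

lemma contingency_tables_entry_le:
  assumes "a \<in> contingency_tables R C n m" "i \<in> R" "j \<in> C"
  shows "a i j \<le> n i" "a i j \<le> m j"
proof -
  have "a i j \<le> (\<Sum>j\<in>C. a i j)" "a i j \<le> (\<Sum>i\<in>R. a i j)"
    using assms(2,3) finite_rows finite_cols by (auto intro: member_le_sum)
  then show "a i j \<le> n i" "a i j \<le> m j"
    using assms by (auto simp: contingency_tables_def)
qed

lemma finite_contingency_tables: "finite (contingency_tables R C n m)"
proof (rule finite_subset)
  let ?row = "{r. \<forall>j. (j \<in> C \<longrightarrow> r j \<in> {..sum m C}) \<and> (j \<notin> C \<longrightarrow> r j = 0)}"
  show "finite {a. \<forall>i. (i \<in> R \<longrightarrow> a i \<in> ?row) \<and> (i \<notin> R \<longrightarrow> a i = (\<lambda>_. 0))}"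
    by (intro finite_set_of_finite_funs finite_rows finite_cols finite_atMost)
  have "a i j \<le> sum m C" if "a \<in> contingency_tables R C n m" "i \<in> R" "j \<in> C" for a i j
    using contingency_tables_entry_le(2)[OF that] member_le_sum[OF that(3) _ finite_cols, of m]
    by simp
  then show "contingency_tables R C n m \<subseteq> {a. \<forall>i. (i \<in> R \<longrightarrow> a i \<in> ?row) \<and> (i \<notin> R \<longrightarrow> a i = (\<lambda>_. 0))}"
    by (auto simp: contingency_tables_def)
qed

lemma contingency_tables_zero:
  assumes "\<And>i. i \<in> R \<Longrightarrow> n i = 0" "\<And>j. j \<in> C \<Longrightarrow> m j = 0"
  shows "contingency_tables R C n m = {\<lambda>_ _. 0}"
proof (rule antisym)
  show "contingency_tables R C n m \<subseteq> {\<lambda>_ _. 0}"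
  proof
    fix a assume a: "a \<in> contingency_tables R C n m"
    have "a i j = 0" for i j
      using contingency_tables_entry_le(1)[OF a, of i j] assms(1)[of i] a
      by (cases "i \<in> R \<and> j \<in> C") (auto simp: contingency_tables_def)
    then show "a \<in> {\<lambda>_ _. 0}" by auto
  qed
  show "{\<lambda>_ _. 0} \<subseteq> contingency_tables R C n m"
    using assms by (simp add: contingency_tables_def)
qed

lemma incr_entry_in_contingency_tables_iff:
  assumes "h \<in> R" "k \<in> C" "m k \<noteq> 0"
  shows "incr_entry h k a \<in> contingency_tables R C (incr h n) m
    \<longleftrightarrow> a \<in> contingency_tables R C n (decr k m)"
proof -
  have row: "(\<Sum>j\<in>C. incr_entry h k a i j) = (\<Sum>j\<in>C. a i j) + of_bool (i = h)" for i
    using assms(2) sum_incr[OF finite_cols, where k = k and f = "a h"] by simp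
  have col: "(\<Sum>i\<in>R. incr_entry h k a i j) = (\<Sum>i\<in>R. a i j) + of_bool (j = k)" for j
  proof -
    have "(\<Sum>i\<in>R. incr_entry h k a i j) = (\<Sum>i\<in>R. a i j + of_bool (i = h) * of_bool (j = k))"
      by (intro sum.cong) auto
    then show ?thesis
      using assms(1) finite_rows by (simp add: sum.distrib)
  qed
  have "incr_entry h k a i j = a i j" if "i \<notin> R \<or> j \<notin> C" for i j
    using that assms(1,2) by auto
  then have "(\<forall>i j. i \<notin> R \<or> j \<notin> C \<longrightarrow> incr_entry h k a i j = 0) \<longleftrightarrow> (\<forall>i j. i \<notin> R \<or> j \<notin> C \<longrightarrow> a i j = 0)"
    by (intro all_cong1 imp_cong refl) (simp only:)
  moreover have "(\<forall>i\<in>R. (\<Sum>j\<in>C. incr_entry h k a i j) = incr h n i) \<longleftrightarrow> (\<forall>i\<in>R. (\<Sum>j\<in>C. a i j) = n i)"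
    unfolding row by auto
  moreover have "(\<forall>j\<in>C. (\<Sum>i\<in>R. incr_entry h k a i j) = m j) \<longleftrightarrow> (\<forall>j\<in>C. (\<Sum>i\<in>R. a i j) = decr k m j)"
    unfolding col using assms(3) by auto
  ultimately show ?thesis
    unfolding contingency_tables_def mem_Collect_eq by (simp only:)
qed

lemma table_weight_incr_entry:
  assumes "h \<in> R" "k \<in> C"
  shows "of_nat (Suc (a h k)) * table_weight R C S (incr_entry h k a)
    = S h k * table_weight R C S a"
proof -
  have "table_weight R C S (incr_entry h k a) = S h k / of_nat (Suc (a h k)) * table_weight R C S a"
    unfolding table_weight_def
  proof (rule prod_scale_one_factor[where x = h])
    show "(\<Prod>j\<in>C. S h j ^ incr_entry h k a h j / fact (incr_entry h k a h j))
        = S h k / of_nat (Suc (a h k)) * (\<Prod>j\<in>C. S h j ^ a h j / fact (a h j))"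
      by (rule prod_scale_one_factor[where x = k])
         (use assms finite_cols in \<open>simp_all add: algebra_simps\<close>)
  qed (use assms finite_rows in simp_all)
  then show ?thesis
    by (simp del: of_nat_Suc)
qed

lemma sum_entry_mult_table_weight:
  assumes h: "h \<in> R" and k: "k \<in> C" and m: "m k \<noteq> 0"
  shows "(\<Sum>a\<in>contingency_tables R C (incr h n) m. of_nat (a h k) * table_weight R C S a)
    = S h k * (\<Sum>a\<in>contingency_tables R C n (decr k m). table_weight R C S a)"
proof -
  let ?T = "contingency_tables R C (incr h n) m"
  note incr_iff = incr_entry_in_contingency_tables_iff[OF h k, of m, OF m]
  have "(\<Sum>a\<in>?T. of_nat (a h k) * table_weight R C S a)
      = (\<Sum>a\<in>{a \<in> ?T. a h k \<noteq> 0}. of_nat (a h k) * table_weight R C S a)"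
    by (intro sum.mono_neutral_right) (auto simp: finite_contingency_tables)
  also have "\<dots> = (\<Sum>a\<in>contingency_tables R C n (decr k m). S h k * table_weight R C S a)"
  proof (rule sum.reindex_bij_witness[where j = "decr_entry h k" and i = "incr_entry h k"])
    fix a assume a: "a \<in> {a \<in> ?T. a h k \<noteq> 0}"
    then show incr_decr: "incr_entry h k (decr_entry h k a) = a"
      by simp
    show "decr_entry h k a \<in> contingency_tables R C n (decr k m)"
      using a incr_iff[of "decr_entry h k a" n] unfolding incr_decr by simp
    show "S h k * table_weight R C S (decr_entry h k a) = of_nat (a h k) * table_weight R C S a"
      using a table_weight_incr_entry[OF h k, of "decr_entry h k a" S] unfolding incr_decr by simp
  next
    fix a assume a: "a \<in> contingency_tables R C n (decr k m)"
    show "decr_entry h k (incr_entry h k a) = a"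
      by simp
    show "incr_entry h k a \<in> {a \<in> ?T. a h k \<noteq> 0}"
      using a by (simp add: incr_iff del: fun_upd_apply) simp
  qed
  finally show ?thesis
    by (simp add: sum_distrib_left)
qed

lemma prod_fact_mult_sum_entry:
  fixes S :: "'i \<Rightarrow> 'j \<Rightarrow> 'a::field_char_0"
  assumes h: "h \<in> R" and k: "k \<in> C"
  shows "(\<Prod>j\<in>C. fact (m j))
      * (\<Sum>a\<in>contingency_tables R C (incr h n) m. of_nat (a h k) * table_weight R C S a)
    = S h k * of_nat (m k) * ((\<Prod>j\<in>C. fact (decr k m j))
        * (\<Sum>a\<in>contingency_tables R C n (decr k m). table_weight R C S a))"
proof (cases "m k = 0")
  case True
  then have "a h k = 0" if "a \<in> contingency_tables R C (incr h n) m" for a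
    using contingency_tables_entry_le(2)[OF that h k] by simp
  then have "(\<Sum>a\<in>contingency_tables R C (incr h n) m. of_nat (a h k) * table_weight R C S a) = 0"
    by (intro sum.neutral) simp
  then show ?thesis using True by simp
next
  case False
  then have "(\<Prod>j\<in>C. fact (m j)) = of_nat (m k) * (\<Prod>j\<in>C. fact (decr k m j) :: 'a)"
    using prod_fact_incr[OF finite_cols k, of "decr k m"] by simp
  then show ?thesis
    by (simp only: sum_entry_mult_table_weight[where m = m, OF h k False] mult_ac)
qed

end

subsection \<open>The Wick recursion\<close>

definition wick_recursion ::
  "'i set \<Rightarrow> 'j set \<Rightarrow> ('i \<Rightarrow> 'j \<Rightarrow> 'a::comm_semiring_1) \<Rightarrow> (('i \<Rightarrow> nat) \<Rightarrow> ('j \<Rightarrow> nat) \<Rightarrow> 'a) \<Rightarrow> bool" where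
  "wick_recursion R C S F \<longleftrightarrow> (\<forall>h\<in>R. \<forall>n m.
     F (incr h n) m = (\<Sum>k\<in>C. S h k * of_nat (m k) * F n (decr k m)))"

lemma wick_recursion_unique:
  assumes "finite R" and F: "wick_recursion R C S F" and G: "wick_recursion R C S G"
    and base: "\<And>n m. \<forall>h\<in>R. n h = 0 \<Longrightarrow> F n m = G n m"
  shows "F n m = G n m"
proof (induction "sum n R" arbitrary: n m)
  case 0
  then show ?case using \<open>finite R\<close> by (intro base) simp
next
  case (Suc N)
  then obtain h where h: "h \<in> R" "n h \<noteq> 0"
    by (metis nat.distinct(1) sum.neutral)
  have "sum n R = Suc (sum (decr h n) R)"
    using sum_incr[OF \<open>finite R\<close>, where k = h and f = "decr h n"] h by simp
  then have N: "N = sum (decr h n) R"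
    using Suc.hyps(2) by simp
  have rec: "H n m = (\<Sum>k\<in>C. S h k * of_nat (m k) * H (decr h n) (decr k m))"
    if "wick_recursion R C S H" for H
  proof -
    have "H (incr h (decr h n)) m = (\<Sum>k\<in>C. S h k * of_nat (m k) * H (decr h n) (decr k m))"
      using that h(1) unfolding wick_recursion_def by blast
    then show ?thesis
      using h(2) by simp
  qed
  show ?case
    unfolding rec[OF F] rec[OF G] by (simp only: Suc.hyps(1)[OF N])
qed

definition wick_sum ::
  "'i set \<Rightarrow> 'j set \<Rightarrow> ('i \<Rightarrow> 'j \<Rightarrow> 'a::field_char_0) \<Rightarrow> ('i \<Rightarrow> nat) \<Rightarrow> ('j \<Rightarrow> nat) \<Rightarrow> 'a" where
  "wick_sum R C S n m = (\<Prod>h\<in>R. fact (n h)) * (\<Prod>k\<in>C. fact (m k))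
     * (\<Sum>a\<in>contingency_tables R C n m. table_weight R C S a)"

lemma wick_recursion_wick_sum:
  fixes S :: "'i \<Rightarrow> 'j \<Rightarrow> 'a::field_char_0"
  assumes fin: "finite R" "finite C"
  shows "wick_recursion R C S (wick_sum R C S)"
  unfolding wick_recursion_def
proof (intro ballI allI)
  fix h n m assume h: "h \<in> R"
  let ?T = "contingency_tables R C (incr h n) m"
  have "of_nat (Suc (n h)) * (\<Sum>a\<in>?T. table_weight R C S a)
      = (\<Sum>a\<in>?T. of_nat (\<Sum>k\<in>C. a h k) * table_weight R C S a)"
    unfolding sum_distrib_left using h by (intro sum.cong refl) (simp add: contingency_tables_def)
  also have "\<dots> = (\<Sum>k\<in>C. \<Sum>a\<in>?T. of_nat (a h k) * table_weight R C S a)"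
    unfolding of_nat_sum sum_distrib_right by (rule sum.swap)
  finally have rows: "of_nat (Suc (n h)) * (\<Sum>a\<in>?T. table_weight R C S a)
      = (\<Sum>k\<in>C. \<Sum>a\<in>?T. of_nat (a h k) * table_weight R C S a)" .
  have "wick_sum R C S (incr h n) m = (\<Prod>h\<in>R. fact (n h)) * ((\<Prod>k\<in>C. fact (m k))
      * (of_nat (Suc (n h)) * (\<Sum>a\<in>?T. table_weight R C S a)))"
    unfolding wick_sum_def prod_fact_incr[OF fin(1) h] by (simp only: mult_ac)
  also have "\<dots> = (\<Prod>h\<in>R. fact (n h))
      * (\<Sum>k\<in>C. (\<Prod>k\<in>C. fact (m k)) * (\<Sum>a\<in>?T. of_nat (a h k) * table_weight R C S a))"
    unfolding rows sum_distrib_left[of _ _ C] ..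
  also have "\<dots> = (\<Sum>k\<in>C. S h k * of_nat (m k) * wick_sum R C S n (decr k m))"
    by (simp add: prod_fact_mult_sum_entry[OF fin h] wick_sum_def sum_distrib_left[of _ _ C]
        mult_ac)
  finally show "wick_sum R C S (incr h n) m
      = (\<Sum>k\<in>C. S h k * of_nat (m k) * wick_sum R C S n (decr k m))" .
qed

lemma wick_sum_zero_rows:
  assumes fin: "finite R" "finite C" and n: "\<forall>h\<in>R. n h = 0"
  shows "wick_sum R C S n m = of_bool (\<forall>k\<in>C. m k = 0)"
proof (cases "\<forall>k\<in>C. m k = 0")
  case True
  then show ?thesis
    using n by (simp add: wick_sum_def contingency_tables_zero[OF fin] table_weight_def)
next
  case False
  then have "sum n R \<noteq> sum m C"
    using fin n by simp
  then have "contingency_tables R C n m = {}"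
    using contingency_tables_total by blast
  then show ?thesis
    using False by (simp add: wick_sum_def)
qed

lemma (in pos_def_inverse) gaussian_moment_eq_wick_sum:
  "gaussian_moment I B n m = gaussian_moment I B (\<lambda>_. 0) (\<lambda>_. 0) * wick_sum I I S n m"
proof (rule wick_recursion_unique[where F = "gaussian_moment I B"
    and G = "\<lambda>n m. gaussian_moment I B (\<lambda>_. 0) (\<lambda>_. 0) * wick_sum I I S n m", OF finite_index])
  let ?Z = "gaussian_moment I B (\<lambda>_. 0) (\<lambda>_. 0)"
  show "wick_recursion I I S (gaussian_moment I B)"
    by (simp add: wick_recursion_def gaussian_moment_incr)
  show "wick_recursion I I S (\<lambda>n m. ?Z * wick_sum I I S n m)"
    using wick_recursion_wick_sum[OF finite_index finite_index, of S]
    by (simp add: wick_recursion_def sum_distrib_left mult_ac)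
  fix n m :: "'i \<Rightarrow> nat" assume n: "\<forall>h\<in>I. n h = 0"
  have "gaussian_moment I B n m = ?Z * of_bool (\<forall>k\<in>I. m k = 0)"
  proof (cases "\<forall>k\<in>I. m k = 0")
    case True
    then show ?thesis
      using n by (simp add: gaussian_moment_def gaussian_integrand_cong[of I n "\<lambda>_. 0" m "\<lambda>_. 0"])
  next
    case False
    then obtain k where k: "k \<in> I" "m k \<noteq> 0" by blast
    then have "gaussian_moment I B m n = 0"
      using gaussian_moment_incr[OF k(1), of "decr k m" n] n by simp
    then show ?thesis
      using False cnj_gaussian_moment[of m n] by simp
  qed
  then show "gaussian_moment I B n m = ?Z * wick_sum I I S n m"
    by (simp add: wick_sum_zero_rows finite_index n)
qed

subsection \<open>The index set\<close>

lemma le_L_bound_iff: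
  "int (a i j) \<le> L_bound n m a i j \<longleftrightarrow> (\<Sum>k\<le>j. a i k) \<le> n i \<and> (\<Sum>h\<le>i. a h j) \<le> m j"
proof -
  have "(\<Sum>k\<le>j. a i k) = (\<Sum>k<j. a i k) + a i j" "(\<Sum>h\<le>i. a h j) = (\<Sum>h<i. a h j) + a i j"
    unfolding lessThan_Suc_atMost[symmetric] by simp_all
  then show ?thesis
    unfolding L_bound_def of_nat_sum[symmetric] by linarith
qed

lemma l_bound_le_iff:
  "l_bound p n m a i j \<le> int (a i j)
    \<longleftrightarrow> (\<Sum>h\<le>i. n h) \<le> (\<Sum>h\<le>i. \<Sum>k\<le>j. a h k) + (\<Sum>k\<in>{j<..<p}. m k)"
proof -
  have "(\<Sum>h\<le>i. \<Sum>k\<le>j. a h k) = a i j + (\<Sum>(h, k)\<in>({..i} \<times> {..j}) - {(i, j)}. a h k)"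
    unfolding sum.cartesian_product by (subst sum.remove[of _ "(i, j)"]) auto
  then show ?thesis
    unfolding l_bound_def split_beta' of_nat_sum[symmetric] by linarith
qed

lemma I_set_row_sum:
  assumes a: "a \<in> I_set p n m" and i: "i < p"
  shows "(\<Sum>j<p. a i j) = n i"
proof -
  obtain q where p: "p = Suc q"
    using i by (cases p) auto
  have row_le: "(\<Sum>k\<le>q. a h k) \<le> n h" if "h < p" for h
    using a that by (simp add: I_set_def le_L_bound_iff p)
  have "{q<..<p} = {}"
    by (auto simp: p)
  then have "(\<Sum>h\<le>q. n h) \<le> (\<Sum>h\<le>q. \<Sum>k\<le>q. a h k)"
    using a l_bound_le_iff[of p n m a q q] by (simp add: I_set_def p)
  moreover have "(\<Sum>h\<le>q. \<Sum>k\<le>q. a h k) \<le> (\<Sum>h\<le>q. n h)"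
    by (intro sum_mono row_le) (simp add: p)
  ultimately have total: "(\<Sum>h\<le>q. \<Sum>k\<le>q. a h k) = (\<Sum>h\<le>q. n h)"
    by (rule antisym[rotated])
  have "(\<Sum>k\<le>q. a i k) = n i"
    by (rule sum_mono_inv[OF total]) (use i in \<open>auto simp: p intro: row_le\<close>)
  then show ?thesis
    by (simp add: p lessThan_Suc_atMost)
qed

lemma I_set_col_sum_le:
  assumes "a \<in> I_set p n m" "j < p"
  shows "(\<Sum>i<p. a i j) \<le> m j"
proof -
  obtain q where p: "p = Suc q"
    using assms(2) by (cases p) auto
  have "(\<Sum>h\<le>q. a h j) \<le> m j"
    using assms by (simp add: I_set_def le_L_bound_iff p)
  then show ?thesis
    by (simp add: p lessThan_Suc_atMost)
qed

lemma contingency_tables_subset_I_set: "contingency_tables {..<p} {..<p} n m \<subseteq> I_set p n m"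
proof
  fix a assume a: "a \<in> contingency_tables {..<p} {..<p} n m"
  then have row: "(\<Sum>k<p. a h k) = n h" and col: "(\<Sum>i<p. a i h) = m h" if "h < p" for h
    using that by (auto simp: contingency_tables_def)
  have col_le: "(\<Sum>h\<le>i. a h k) \<le> m k" if "i < p" "k < p" for i k
    using that by (subst col[symmetric]) (auto intro: sum_mono2)
  have row_le: "(\<Sum>k\<le>j. a i k) \<le> n i" if "i < p" "j < p" for i j
    using that by (subst row[symmetric]) (auto intro: sum_mono2)
  have "(\<Sum>h\<le>i. n h) \<le> (\<Sum>h\<le>i. \<Sum>k\<le>j. a h k) + (\<Sum>k\<in>{j<..<p}. m k)" if ij: "i < p" "j < p" for i j
  proof -
    have split: "{..<p} = {..j} \<union> {j<..<p}" using ij by auto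
    have "(\<Sum>h\<le>i. n h) = (\<Sum>h\<le>i. \<Sum>k<p. a h k)"
      using ij by (intro sum.cong refl) (simp add: row)
    also have "\<dots> = (\<Sum>h\<le>i. \<Sum>k\<le>j. a h k) + (\<Sum>k\<in>{j<..<p}. \<Sum>h\<le>i. a h k)"
      unfolding split by (subst sum.union_disjoint) (auto simp: sum.distrib intro: sum.swap)
    also have "(\<Sum>k\<in>{j<..<p}. \<Sum>h\<le>i. a h k) \<le> (\<Sum>k\<in>{j<..<p}. m k)"
      using ij by (intro sum_mono col_le) auto
    finally show ?thesis by simp
  qed
  then show "a \<in> I_set p n m"
    using a row_le col_le
    by (auto simp: I_set_def le_L_bound_iff l_bound_le_iff contingency_tables_def)
qed

lemma I_set_eq_contingency_tables:
  assumes "(\<Sum>i<p. n i) = (\<Sum>j<p. m j)"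
  shows "I_set p n m = contingency_tables {..<p} {..<p} n m"
proof (rule antisym[OF _ contingency_tables_subset_I_set], rule subsetI)
  fix a assume a: "a \<in> I_set p n m"
  have "(\<Sum>j<p. \<Sum>i<p. a i j) = (\<Sum>i<p. \<Sum>j<p. a i j)"
    by (rule sum.swap)
  also have "\<dots> = (\<Sum>j<p. m j)"
    using assms by (simp add: I_set_row_sum[OF a])
  finally have total: "(\<Sum>j<p. \<Sum>i<p. a i j) = (\<Sum>j<p. m j)" .
  have "(\<Sum>i<p. a i j) = m j" if "j < p" for j
    by (rule sum_mono_inv[OF total]) (use that I_set_col_sum_le[OF a] in auto)
  then show "a \<in> contingency_tables {..<p} {..<p} n m"
    using a by (auto simp: contingency_tables_def I_set_row_sum[OF a] I_set_def not_less)
qed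

subsection \<open>The balance condition\<close>

definition induced_edges :: "nat set \<Rightarrow> nat set \<Rightarrow> (nat \<Rightarrow> nat set) \<Rightarrow> (nat \<times> nat) set" where
  "induced_edges V H T = {(j, k). j \<in> V \<and> k \<in> V \<and> (\<exists>h\<in>H. j \<in> T h \<and> k \<in> T h)}"

lemma induced_partition_altdef:
  "induced_partition V H T = (\<lambda>x. {y \<in> V. (x, y) \<in> (induced_edges V H T)\<^sup>*}) ` V"
  unfolding induced_partition_def Let_def induced_edges_def[symmetric] by blast

lemma partition_on_induced_partition: "partition_on V (induced_partition V H T)"
proof -
  define r where "r = (induced_edges V H T)\<^sup>* \<inter> V \<times> V"
  have "sym ((induced_edges V H T)\<^sup>*)"
    by (intro sym_rtrancl) (auto simp: induced_edges_def sym_def)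
  then have "sym r"
    unfolding r_def by (intro sym_Int) (auto simp: sym_def)
  moreover have "trans r"
    unfolding r_def by (intro trans_Int trans_rtrancl) (auto simp: trans_def)
  ultimately have "equiv V r"
    by (intro equivI) (auto simp: r_def refl_on_def)
  moreover have "induced_partition V H T = V // r"
    unfolding induced_partition_altdef quotient_def r_def by blast
  ultimately show ?thesis
    by (simp add: partition_on_quotient)
qed

lemma induced_partition_block:
  assumes "h \<in> H" "T h \<subseteq> V" "T h \<noteq> {}"
  shows "\<exists>C\<in>induced_partition V H T. T h \<subseteq> C"
proof -
  obtain x where x: "x \<in> T h"
    using assms(3) by blast
  have "(x, y) \<in> induced_edges V H T" if "y \<in> T h" for y
    using that x assms(1,2) by (auto simp: induced_edges_def)
  then have "T h \<subseteq> {y \<in> V. (x, y) \<in> (induced_edges V H T)\<^sup>*}"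
    using assms(2) by blast
  moreover have "{y \<in> V. (x, y) \<in> (induced_edges V H T)\<^sup>*} \<in> induced_partition V H T"
    using x assms(2) unfolding induced_partition_altdef by blast
  ultimately show ?thesis
    by (rule bexI)
qed

lemma sum_by_enclosing_block:
  fixes n :: "'i \<Rightarrow> 'a::comm_monoid_add"
  assumes P: "partition_on V P" "finite P" and H: "finite H"
    and T: "\<And>h. h \<in> H \<Longrightarrow> T h \<noteq> {}" "\<And>h. h \<in> H \<Longrightarrow> \<exists>C\<in>P. T h \<subseteq> C"
  shows "(\<Sum>i\<in>H. n i) = (\<Sum>C\<in>P. \<Sum>i\<in>{i \<in> H. T i \<subseteq> C}. n i)"
proof -
  have "{i \<in> H. T i \<subseteq> C} \<inter> {i \<in> H. T i \<subseteq> D} = {}" if "C \<in> P" "D \<in> P" "C \<noteq> D" for C D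
  proof -
    have "C \<inter> D = {}"
      using partition_onD2[OF P(1)] that by (rule disjointD)
    have False if "i \<in> H" "T i \<subseteq> C" "T i \<subseteq> D" for i
      using T(1)[OF that(1)] that(2,3) \<open>C \<inter> D = {}\<close> by auto
    then show ?thesis by auto
  qed
  then have "(\<Sum>i\<in>(\<Union>C\<in>P. {i \<in> H. T i \<subseteq> C}). n i) = (\<Sum>C\<in>P. \<Sum>i\<in>{i \<in> H. T i \<subseteq> C}. n i)"
    using P(2) H by (intro sum.UNION_disjoint) auto
  moreover have "(\<Union>C\<in>P. {i \<in> H. T i \<subseteq> C}) = H"
    using T(2) by auto
  ultimately show ?thesis
    by (simp only:)
qed

lemma sum_eq_if_blocks_balanced:
  fixes n m :: "nat \<Rightarrow> nat"
  assumes fin: "finite V" "finite H"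
    and T: "\<And>h. h \<in> H \<Longrightarrow> T h \<noteq> {}" "\<And>h. h \<in> H \<Longrightarrow> T h \<subseteq> V"
    and balanced: "\<And>C. C \<in> induced_partition V H T
      \<Longrightarrow> (\<Sum>i\<in>{i \<in> H. T i \<subseteq> C}. n i) = (\<Sum>j\<in>C. m j)"
  shows "(\<Sum>i\<in>H. n i) = (\<Sum>j\<in>V. m j)"
proof -
  let ?P = "induced_partition V H T"
  note P = partition_on_induced_partition[of V H T]
  have "(\<Sum>i\<in>H. n i) = (\<Sum>C\<in>?P. \<Sum>i\<in>{i \<in> H. T i \<subseteq> C}. n i)"
    using P finite_elements[OF fin(1) P] fin(2)
    by (rule sum_by_enclosing_block) (use T in \<open>auto intro!: induced_partition_block\<close>)
  also have "\<dots> = (\<Sum>C\<in>?P. \<Sum>j\<in>C. m j)"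
    by (intro sum.cong refl balanced)
  also have "\<dots> = (\<Sum>j\<in>V. m j)"
    by (rule sum.partition[symmetric, OF fin(1) P])
  finally show ?thesis .
qed

subsection \<open>Moments of the complex normal distribution\<close>

lemma totals_eq_or_isolated:
  fixes n m :: "nat \<Rightarrow> nat"
  assumes T: "\<And>h. T h \<subseteq> {k. k < p \<and> m k \<noteq> 0}"
    and balanced: "\<forall>C\<in>induced_partition {k. k < p \<and> m k \<noteq> 0} {h. h < p \<and> n h \<noteq> 0} T.
      (\<Sum>i\<in>{i. i < p \<and> n i \<noteq> 0 \<and> T i \<subseteq> C}. n i) = (\<Sum>j\<in>C. m j)"
  shows "(\<Sum>i<p. n i) = (\<Sum>j<p. m j) \<or> (\<exists>h<p. n h \<noteq> 0 \<and> T h = {})"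
proof (rule disjCI)
  assume no_isolated: "\<not> (\<exists>h<p. n h \<noteq> 0 \<and> T h = {})"
  have supp: "(\<Sum>i<p. f i) = (\<Sum>i\<in>{i. i < p \<and> f i \<noteq> 0}. f i)" for f :: "nat \<Rightarrow> nat"
    by (intro sum.mono_neutral_right) auto
  show "(\<Sum>i<p. n i) = (\<Sum>j<p. m j)"
    unfolding supp
  proof (rule sum_eq_if_blocks_balanced[where T = T])
    fix C assume "C \<in> induced_partition {k. k < p \<and> m k \<noteq> 0} {h. h < p \<and> n h \<noteq> 0} T"
    then show "(\<Sum>i\<in>{i \<in> {h. h < p \<and> n h \<noteq> 0}. T i \<subseteq> C}. n i) = (\<Sum>j\<in>C. m j)"
      using balanced by (simp add: conj_assoc)
  qed (use no_isolated T in auto)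
qed

lemma Pi_term_eq_0_if_isolated:
  assumes a: "a \<in> I_set p n m" and h: "h < p" "n h \<noteq> 0"
    and isolated: "{k. k < p \<and> m k \<noteq> 0 \<and> S $$ (h, k) \<noteq> 0} = {}"
  shows "Pi_term p S n m a = 0"
proof -
  have "(\<Sum>k<p. a h k) \<noteq> 0"
    using I_set_row_sum[OF a h(1)] h(2) by simp
  then obtain k where k: "k < p" "a h k \<noteq> 0"
    by (metis lessThan_iff sum.neutral)
  have "a h k \<le> (\<Sum>i<p. a i k)"
    using h(1) by (intro member_le_sum) auto
  then have "m k \<noteq> 0"
    using I_set_col_sum_le[OF a k(1)] k(2) by simp
  then have "S $$ (h, k) ^ a h k / of_nat (fact (a h k)) = 0"
    using isolated k by auto
  then have "(\<Prod>h<p. \<Prod>k<p. S $$ (h, k) ^ a h k / of_nat (fact (a h k))) = 0"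
    using h(1) k(1) by (intro prod_zero bexI[of _ h] bexI[of _ k]) auto
  then show ?thesis by (simp add: Pi_term_def)
qed

lemma scalar_prod_eq_sesq_form:
  assumes "A \<in> carrier_mat p p"
  shows "scalar_prod (conjugate (Matrix.vec p z)) (A *\<^sub>v Matrix.vec p z)
    = sesq_form {..<p} (\<lambda>i j. A $$ (i, j)) z z"
  using assms by (simp add: sesq_form_def scalar_prod_def atLeast0LessThan)

lemma hermitian_pd_det_nonzero:
  assumes "hermitian_pd p S"
  shows "Determinant.det S \<noteq> 0"
proof
  have S: "S \<in> carrier_mat p p" using assms by (simp add: hermitian_pd_def)
  assume "Determinant.det S = 0"
  then obtain v where v: "v \<in> carrier_vec p" "v \<noteq> 0\<^sub>v p" "S *\<^sub>v v = 0\<^sub>v p"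
    using det_0_iff_vec_prod_zero[OF S] by auto
  have "0 < Re (scalar_prod (conjugate v) (S *\<^sub>v v))"
    using assms v(1,2) unfolding hermitian_pd_def by blast
  with v show False by simp
qed

lemma inv_mat_inverse:
  assumes S: "S \<in> carrier_mat p p" and det: "Determinant.det S \<noteq> 0"
  shows "inv_mat p S \<in> carrier_mat p p \<and> S * inv_mat p S = 1\<^sub>m p \<and> inv_mat p S * S = 1\<^sub>m p"
  unfolding inv_mat_def
proof (rule theI')
  obtain C where C: "C \<in> carrier_mat p p" "S * C = 1\<^sub>m p" "C * S = 1\<^sub>m p"
    using det_non_zero_imp_unit[OF S det, of p] by (auto simp: Units_def ring_mat_def)
  moreover have "D = C" if D: "D \<in> carrier_mat p p" "D * S = 1\<^sub>m p" for D
  proof -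
    have "D = D * (S * C)" using C D by simp
    also have "\<dots> = (D * S) * C" using C D S by (intro assoc_mult_mat[symmetric]) auto
    also have "\<dots> = C" using C D by simp
    finally show ?thesis .
  qed
  ultimately show "\<exists>!C. C \<in> carrier_mat p p \<and> S * C = 1\<^sub>m p \<and> C * S = 1\<^sub>m p"
    by blast
qed

lemma hermitian_pd_imp_pos_def_inverse:
  assumes "hermitian_pd p S"
  shows "pos_def_inverse {..<p} (\<lambda>i j. S $$ (i, j)) (\<lambda>i j. inv_mat p S $$ (i, j))"
proof
  have S: "S \<in> carrier_mat p p" using assms by (simp add: hermitian_pd_def)
  have B: "inv_mat p S \<in> carrier_mat p p" "S * inv_mat p S = 1\<^sub>m p"
    using inv_mat_inverse[OF S hermitian_pd_det_nonzero[OF assms]] by auto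
  show "cnj (S $$ (i, j)) = S $$ (j, i)" if "i \<in> {..<p}" "j \<in> {..<p}" for i j
    using assms that unfolding hermitian_pd_def by (metis lessThan_iff)
  show "0 < Re (sesq_form {..<p} (\<lambda>i j. S $$ (i, j)) v v)" if "i \<in> {..<p}" "v i \<noteq> 0" for v i
  proof -
    have "Matrix.vec p v \<noteq> 0\<^sub>v p"
      using that by (metis index_vec index_zero_vec(1) lessThan_iff)
    then show ?thesis
      using assms vec_carrier[of p v]
      unfolding hermitian_pd_def scalar_prod_eq_sesq_form[OF S, symmetric] by blast
  qed
  show "(\<Sum>k<p. S $$ (i, k) * inv_mat p S $$ (k, j)) = of_bool (i = j)"
    if "i \<in> {..<p}" "j \<in> {..<p}" for i j
  proof -
    have "(\<Sum>k<p. S $$ (i, k) * inv_mat p S $$ (k, j)) = (S * inv_mat p S) $$ (i, j)"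
      using S B(1) that by (simp add: scalar_prod_def atLeast0LessThan)
    then show ?thesis
      using that by (simp add: B(2))
  qed
qed simp

lemma cn_moment_eq_sum_contingency_tables:
  assumes "hermitian_pd p S"
  shows "cn_moment p S n m = (\<Sum>a\<in>contingency_tables {..<p} {..<p} n m. Pi_term p S n m a)"
proof -
  have S: "S \<in> carrier_mat p p" using assms by (simp add: hermitian_pd_def)
  note det = hermitian_pd_det_nonzero[OF assms]
  note pos_def = hermitian_pd_imp_pos_def_inverse[OF assms]
  interpret pos_def_inverse "{..<p}" "\<lambda>i j. S $$ (i, j)" "\<lambda>i j. inv_mat p S $$ (i, j)"
    by (rule pos_def)
  define Z where "Z = complex_of_real pi ^ p * Determinant.det S"
  have "mat p p (\<lambda>(i, j). S $$ (i, j)) = S" using S by auto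
  then have Z: "gaussian_moment {..<p} (\<lambda>i j. inv_mat p S $$ (i, j)) (\<lambda>_. 0) (\<lambda>_. 0) = Z"
    using gaussian_moment_0[OF pos_def] by (simp add: Z_def)
  have "cn_moment p S n m = gaussian_moment {..<p} (\<lambda>i j. inv_mat p S $$ (i, j)) n m / Z"
    using inv_mat_inverse[OF S det]
    by (simp add: cn_moment_def gaussian_moment_def gaussian_integrand_def cn_density_def Let_def
        lebesgue_Cp_def scalar_prod_eq_sesq_form Z_def)
  also have "\<dots> = wick_sum {..<p} {..<p} (\<lambda>i j. S $$ (i, j)) n m"
    using det by (simp add: gaussian_moment_eq_wick_sum[of n m] Z) (simp add: Z_def)
  also have "\<dots> = (\<Sum>a\<in>contingency_tables {..<p} {..<p} n m. Pi_term p S n m a)"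
    by (simp add: wick_sum_def table_weight_def Pi_term_def sum_distrib_left prod.distrib)
  finally show ?thesis .
qed

theorem theorem3p15:
  fixes p :: nat and S :: "complex mat" and n m :: "nat \<Rightarrow> nat"
  assumes "hermitian_pd p S"
    and "\<forall>Mr \<in> induced_partition {k. k < p \<and> m k \<noteq> 0} {h. h < p \<and> n h \<noteq> 0}
                (\<lambda>h. {k. k < p \<and> m k \<noteq> 0 \<and> S $$ (h,k) \<noteq> 0}).
           (\<Sum>i \<in> {i. i < p \<and> n i \<noteq> 0 \<and> {k. k < p \<and> m k \<noteq> 0 \<and> S $$ (i,k) \<noteq> 0} \<subseteq> Mr}. n i)
           = (\<Sum>j\<in>Mr. m j)"
  shows "cn_moment p S n m = (\<Sum>a \<in> I_set p n m. Pi_term p S n m a)"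
proof (cases "(\<Sum>i<p. n i) = (\<Sum>j<p. m j)")
  case True
  then show ?thesis
    by (simp add: cn_moment_eq_sum_contingency_tables[OF assms(1)] I_set_eq_contingency_tables)
next
  case False
  then have "contingency_tables {..<p} {..<p} n m = {}"
    using contingency_tables_total by blast
  then have "cn_moment p S n m = 0"
    by (simp add: cn_moment_eq_sum_contingency_tables[OF assms(1)])
  moreover obtain h where "h < p" "n h \<noteq> 0" "{k. k < p \<and> m k \<noteq> 0 \<and> S $$ (h, k) \<noteq> 0} = {}"
    using totals_eq_or_isolated[OF _ assms(2)] False by blast
  then have "(\<Sum>a\<in>I_set p n m. Pi_term p S n m a) = 0"
    by (intro sum.neutral ballI Pi_term_eq_0_if_isolated)
  ultimately show ?thesis by simp
qed

end
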